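(* Let $\{(\Omega_i,\Sigma_i,\mu_i)\}_{i\in\mathbb{N}}$ be a family of measure spaces. Then there exists a measure $\bigotimes_{i\in\mathbb{N}}\mu_i$ on the measurable space $\left(\prod_{i\in\mathbb{N}}\Omega_i,\ \bigotimes_{i\in\mathbb{N}}\Sigma_i\right)$ such that, for every finite rectangle $\mathscr{C}=\prod_{i\in\mathbb{N}}C_i\in\mathcal{F}(\Sigma_i,\mu_i)_{i\in\mathbb{N}}$, $$\Big(\bigotimes_{i\in\mathbb{N}}\mu_i\Big)(\mathscr{C})=\prod_{i\in\mathbb{N}}\mu_i(C_i),$$ where the right-hand side is the infinite product of real numbers.
   Context: No condition (such as $\sigma$-finiteness or any topological structure) is imposed on the measure spaces. $\mathbb{N}=\{1,2,3,\dots\}$. For sets $C_i$, $\prod_{i\in\mathbb{N}}C_i$ denotes the Cartesian product. For a sequence $(a_i)_{i\in\mathbb{N}}\subset[0,\infty)$ of real numbers, the infinite product is $\prod_{i\in\mathbb{N}}a_i:=\lim_{n\to\infty}\prod_{i=1}^n a_i$ (when the limit exists; the value $0$ is allowed). $\bigotimes_{i\in\mathbb{N}}\Sigma_i$ is the $\sigma$-algebra on $\prod_{i\in\mathbb{N}}\Omega_i$ generated by the cylinder sets $$\mathcal{C}(\Sigma_i)_{i\in\mathbb{N}}:=\Big\{\prod_{i=1}^m C_i\times\prod_{i=m+1}^\infty\Omega_i : m\in\mathbb{N},\ C_i\in\Sigma_i \text{ for all } i\in\{1,\dots,m\}\Big\}.$$ The set of rectangles is $\mathcal{R}(\Sigma_i,\mu_i)_{i\in\mathbb{N}}:=\{\prod_{i\in\mathbb{N}}C_i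 : C_i\in\Sigma_i \text{ for all } i\in\mathbb{N}\}$. The set of finite rectangles is $$\mathcal{F}(\Sigma_i,\mu_i)_{i\in\mathbb{N}}:=\Big\{\prod_{i\in\mathbb{N}}C_i\in\mathcal{R}(\Sigma_i,\mu_i)_{i\in\mathbb{N}} : \prod_{i\in\mathbb{N}}\mu_i(C_i)\in[0,\infty)\Big\},$$ where the condition means that every $\mu_i(C_i)$ is finite and that the limit defining $\prod_{i\in\mathbb{N}}\mu_i(C_i)$ exists and is finite. *)

theory Defs
  imports "HOL-Analysis.Analysis"
begin

text \<open>
  The natural numbers are counted from 0, so \<open>\<Prod>i<n. a i\<close> is the product of the first
  \<open>n\<close> factors.  The spaces \<open>\<Omega>\<^sub>i\<close> are arbitrary sets \<open>space (M i)\<close> inside one common type.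
\<close>

text \<open>
  Not \<^const>\<open>prodinf\<close>: the library's notion of convergence of infinite products excludes sequences of
  nonzero factors whose partial products tend to 0, whereas here the value 0 is allowed.
\<close>

definition inf_prod_exists :: "(nat \<Rightarrow> real) \<Rightarrow> bool" where
  "inf_prod_exists a \<longleftrightarrow> convergent (\<lambda>n. \<Prod>i<n. a i)"

definition inf_prod :: "(nat \<Rightarrow> real) \<Rightarrow> real" where
  "inf_prod a = lim (\<lambda>n. \<Prod>i<n. a i)"

text \<open>
  The sides of a finite rectangle.  The predicate is on the sequence of sides rather than on the
  rectangle, since an empty rectangle has many sequences of sides, and some of them may have a side
  of infinite measure.
\<close>

definition finite_rectangle :: "(nat \<Rightarrow> 'a measure) \<Rightarrow> (nat \<Rightarrow> 'a set) \<Rightarrow> bool" where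
  "finite_rectangle M C \<longleftrightarrow>
     (\<forall>i. C i \<in> sets (M i)) \<and>
     (\<forall>i. emeasure (M i) (C i) < \<infinity>) \<and>
     inf_prod_exists (\<lambda>i. measure (M i) (C i))"

definition cylinder_sets :: "(nat \<Rightarrow> 'a measure) \<Rightarrow> (nat \<Rightarrow> 'a) set set" where
  "cylinder_sets M =
     {Pi\<^sub>E UNIV (\<lambda>i. if i < m then C i else space (M i)) | m C.
        1 \<le> m \<and> (\<forall>i<m. C i \<in> sets (M i))}"

text \<open>The \<open>\<sigma>\<close>-algebra of \<^const>\<open>PiM\<close> is the one generated by the cylinder sets.\<close>

lemma sets_PiM_eq_sigma_cylinder_sets:
  "sets (PiM UNIV M) = sigma_sets (Pi\<^sub>E UNIV (\<lambda>i. space (M i))) (cylinder_sets M)"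
proof (rule antisym)
  let ?S = "Pi\<^sub>E UNIV (\<lambda>i. space (M i))"
  show "sets (PiM UNIV M) \<subseteq> sigma_sets ?S (cylinder_sets M)"
    unfolding sets_PiM_single
  proof (rule sigma_sets_mono', clarify)
    fix i :: nat and A assume A: "A \<in> sets (M i)"
    have "{f \<in> ?S. f i \<in> A} =
        Pi\<^sub>E UNIV (\<lambda>j. if j < Suc i then (if j = i then A else space (M j)) else space (M j))"
      using sets.sets_into_space[OF A] by (auto simp: PiE_iff split: if_splits) (metis subsetD)
    moreover have "\<dots> \<in> cylinder_sets M"
      unfolding cylinder_sets_def using A
      by (intro CollectI exI[of _ "Suc i"] exI[of _ "\<lambda>j. if j = i then A else space (M j)"]) auto
    ultimately show "{f \<in> ?S. f i \<in> A} \<in> cylinder_sets M" by simp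
  qed
  have "cylinder_sets M \<subseteq> sets (PiM UNIV M)"
  proof
    fix X assume "X \<in> cylinder_sets M"
    then obtain m C where X: "X = Pi\<^sub>E UNIV (\<lambda>i. if i < m then C i else space (M i))"
      and C: "\<And>i. i < m \<Longrightarrow> C i \<in> sets (M i)"
      by (auto simp: cylinder_sets_def)
    show "X \<in> sets (PiM UNIV M)"
      unfolding X by (rule sets_PiM_I_countable) (auto simp: C)
  qed
  then show "sigma_sets ?S (cylinder_sets M) \<subseteq> sets (PiM UNIV M)"
    using sets.sigma_sets_subset[of "cylinder_sets M" "PiM UNIV M"] by (simp add: space_PiM)
qed

end

theory Submission
  imports Defs "HOL-Probability.Infinite_Product_Measure"
begin

text \<open>
  Let \<open>C\<close> be a finite rectangle of positive volume \<open>v\<close>.  All its sides have positive finite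
  measure, so they can be normalised to probability spaces, and \<open>v\<close> times the product of these
  probability measures is a finite measure \<open>\<nu>\<^sub>C\<close> on the infinite product
  (\<open>rectangle_measure\<close>), which lives on \<open>C\<close>.  Its value on any
  measurable rectangle \<open>\<Prod>E\<^sub>i\<close> is the limit of the partial products of
  \<open>\<mu>\<^sub>i(C\<^sub>i \<inter> E\<^sub>i)\<close>: the normalising constants cancel against \<open>v\<close>.
  For volume 0, \<open>\<nu>\<^sub>C\<close> is the zero measure.

  The limit formula is symmetric in \<open>C\<close> and \<open>E\<close>.  Hence \<open>\<nu>\<^sub>D(C \<inter> Z) = \<nu>\<^sub>C(D \<inter> Z)\<close> for
  cylinders \<open>Z\<close>, and therefore for all measurable \<open>Z\<close>.  In particular \<open>\<nu>\<^sub>D \<le> \<nu>\<^sub>C\<close> on the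
  measurable subsets of \<open>C\<close>, for every finite rectangle \<open>D\<close>
  (\<open>rectangle_measure_le_on_rectangle\<close>).

  The required measure is the supremum of all \<open>\<nu>\<^sub>D\<close> in the complete lattice of measures.  On \<open>C\<close>
  it is at least \<open>\<nu>\<^sub>C(C) = v\<close>.  It is also at most \<open>v\<close>, because the measure that agrees with
  \<open>\<nu>\<^sub>C\<close> on subsets of \<open>C\<close> and is infinite on all other sets is an upper bound of the family
  (\<open>emeasure_SUP_le_on\<close>).
\<close>

section \<open>Suprema of measures that are dominated on one set\<close>

text \<open>
  A supremum of measures is not computed setwise, but it lies below every measure that bounds the
  whole family.  Domination on \<open>C\<close> suffices for this: adding infinite mass to each point outside
  \<open>C\<close> makes the dominating measure a global upper bound and does not change its value on \<open>C\<close>.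
\<close>

lemma emeasure_SUP_le_on:
  fixes \<nu> :: "'i \<Rightarrow> 'a measure"
  assumes I: "I \<noteq> {}" and sets_\<nu>: "\<And>i. i \<in> I \<Longrightarrow> sets (\<nu> i) = sets N"
    and C: "C \<in> sets N"
    and le: "\<And>i X. i \<in> I \<Longrightarrow> X \<in> sets N \<Longrightarrow> X \<subseteq> C \<Longrightarrow> emeasure (\<nu> i) X \<le> emeasure N X"
  shows "emeasure (SUP i\<in>I. \<nu> i) C \<le> emeasure N C"
proof -
  let ?K = "scale_measure \<infinity> (count_space UNIV) :: 'a measure"
  define m where "m X = emeasure N X + emeasure ?K (X - C)" for X
  define R where "R = measure_of (space N) (sets N) m"
  have "countably_additive (sets N) m"
    unfolding countably_additive_def
  proof (intro allI impI)
    fix A :: "nat \<Rightarrow> 'a set"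
    assume A: "range A \<subseteq> sets N" "disjoint_family A"
    have "disjoint_family (\<lambda>i. A i - C)"
      using A(2) by (auto simp: disjoint_family_on_def)
    then have "(\<Sum>i. emeasure ?K (A i - C)) = emeasure ?K (\<Union>i. A i - C)"
      by (intro suminf_emeasure) auto
    moreover have "(\<Sum>i. emeasure N (A i)) = emeasure N (\<Union>i. A i)"
      using A by (rule suminf_emeasure)
    moreover have "(\<Union>i. A i - C) = (\<Union>i. A i) - C"
      by auto
    ultimately show "(\<Sum>i. m (A i)) = m (\<Union>i. A i)"
      unfolding m_def by (subst suminf_add[symmetric]) auto
  qed
  moreover have "positive (sets N) m"
    by (simp add: positive_def m_def)
  ultimately have emeasure_R: "emeasure R X = m X" if "X \<in> sets N" for X
    unfolding R_def using that sets.sigma_algebra_axioms by (intro emeasure_measure_of_sigma)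
  have sets_R: "sets R = sets N" and space_R: "space R = space N"
    by (simp_all add: R_def)
  have "\<nu> i \<le> R" if i: "i \<in> I" for i
  proof -
    have "emeasure (\<nu> i) X \<le> emeasure R X" for X
    proof (cases "X \<in> sets N")
      case False
      then show ?thesis using sets_\<nu>[OF i] by (simp add: emeasure_notin_sets)
    next
      case X: True
      show ?thesis
      proof (cases "X \<subseteq> C")
        case True
        then show ?thesis
          using le[OF i X] X by (simp add: emeasure_R m_def add_increasing2)
      next
        case False
        then have "emeasure (count_space UNIV) (X - C) \<noteq> 0"
          by (simp add: emeasure_count_space_eq_0)
        then show ?thesis
          using X by (simp add: emeasure_R m_def ennreal_top_mult)
      qed
    qed
    then show ?thesis
      using sets_\<nu>[OF i] sets_eq_imp_space_eq[OF sets_\<nu>[OF i]] sets_R space_R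
      by (simp add: le_measure_iff le_fun_def)
  qed
  then have "(SUP i\<in>I. \<nu> i) \<le> R"
    by (rule SUP_least)
  moreover have "sets (SUP i\<in>I. \<nu> i) = sets R"
    unfolding sets_R using sets_\<nu> I by (rule sets_SUP)
  ultimately have "emeasure (SUP i\<in>I. \<nu> i) C \<le> emeasure R C"
    by (rule le_measureD3)
  also have "\<dots> = emeasure N C"
    using C by (simp add: emeasure_R m_def)
  finally show ?thesis .
qed

section \<open>The measure carried by a finite rectangle\<close>

text \<open>
  An infinite rectangle is the decreasing intersection of the cylinders over its first \<open>n\<close> sides, so
  this is continuity from above.
\<close>

lemma prod_measure_tendsto_PiM:
  fixes P :: "nat \<Rightarrow> 'a measure"
  assumes P: "\<And>i. prob_space (P i)" and E: "\<And>i. E i \<in> sets (P i)"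
  shows "(\<lambda>n. \<Prod>i<n. measure (P i) (E i)) \<longlonglongrightarrow> measure (PiM UNIV P) (Pi\<^sub>E UNIV E)"
proof -
  interpret factor: prob_space "P i" for i by (rule P)
  interpret product_prob_space P UNIV by unfold_locales
  let ?E = "\<lambda>n. prod_emb UNIV P {..<n} (Pi\<^sub>E {..<n} E)"
  have "(\<Prod>i<n. measure (P i) (E i)) = measure (PiM UNIV P) (?E n)" for n
    using E by (simp add: measure_PiM_emb)
  moreover have "Pi\<^sub>E UNIV E = (\<Inter>n. ?E n)"
    using E[THEN sets.sets_into_space]
    by (fastforce simp: prod_emb_def PiE_iff)
  moreover have "range ?E \<subseteq> sets (PiM UNIV P)"
    using E by auto
  moreover have "decseq ?E"
    by (auto simp: prod_emb_def decseq_def PiE_iff)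
  ultimately show ?thesis
    by (simp add: finite_Lim_measure_decseq)
qed

abbreviation (input) rectangle_volume :: "(nat \<Rightarrow> 'a measure) \<Rightarrow> (nat \<Rightarrow> 'a set) \<Rightarrow> real" where
  "rectangle_volume M C \<equiv> inf_prod (\<lambda>i. measure (M i) (C i))"

text \<open>
  If the volume is 0, some side may be a null set, which has no normalisation; the factor 0
  turns whatever \<^const>\<open>PiM\<close> yields into the zero measure.
\<close>

definition rectangle_measure ::
    "(nat \<Rightarrow> 'a measure) \<Rightarrow> (nat \<Rightarrow> 'a set) \<Rightarrow> (nat \<Rightarrow> 'a) measure" where
  "rectangle_measure M C =
     scale_measure (ennreal (rectangle_volume M C)) (PiM UNIV (\<lambda>i. uniform_measure (M i) (C i)))"

lemma sets_rectangle_measure [simp]: "sets (rectangle_measure M C) = sets (PiM UNIV M)"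
  unfolding rectangle_measure_def by (simp cong: sets_PiM_cong)

lemma finite_rectangle_sets: "finite_rectangle M C \<Longrightarrow> C i \<in> sets (M i)"
  by (simp add: finite_rectangle_def)

lemma finite_rectangle_tendsto:
  "finite_rectangle M C \<Longrightarrow> (\<lambda>n. \<Prod>i<n. measure (M i) (C i)) \<longlonglongrightarrow> rectangle_volume M C"
  by (simp add: finite_rectangle_def inf_prod_exists_def inf_prod_def convergent_LIMSEQ_iff)

lemma volume_nonneg:
  assumes "finite_rectangle M C"
  shows "0 \<le> rectangle_volume M C"
  using finite_rectangle_tendsto[OF assms]
  by (rule LIMSEQ_le_const) (auto intro!: prod_nonneg)

lemma measure_side_pos:
  assumes C: "finite_rectangle M C" and pos: "0 < rectangle_volume M C"
  shows "0 < measure (M i) (C i)"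
proof (rule ccontr)
  assume "\<not> 0 < measure (M i) (C i)"
  then have "measure (M i) (C i) = 0"
    using measure_nonneg[of "M i" "C i"] by linarith
  then have "\<forall>\<^sub>F n in sequentially. (\<Prod>j<n. measure (M j) (C j)) = 0"
    by (intro eventually_sequentiallyI[of "Suc i"]) auto
  then have "(\<lambda>n. \<Prod>j<n. measure (M j) (C j)) \<longlonglongrightarrow> 0"
    by (rule tendsto_eventually)
  with finite_rectangle_tendsto[OF C] have "rectangle_volume M C = 0"
    by (rule LIMSEQ_unique)
  with pos show False by simp
qed

lemma prob_space_side:
  assumes C: "finite_rectangle M C" and pos: "0 < rectangle_volume M C"
  shows "prob_space (uniform_measure (M i) (C i))"
  using C measure_side_pos[OF C pos, of i]
  by (intro prob_space_uniform_measure) (auto simp: finite_rectangle_def measure_def)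

lemma finite_measure_rectangle_measure:
  assumes C: "finite_rectangle M C" and pos: "0 < rectangle_volume M C"
  shows "finite_measure (rectangle_measure M C)"
proof -
  interpret prob_space "PiM UNIV (\<lambda>i. uniform_measure (M i) (C i))"
    by (intro prob_space_PiM prob_space_side C pos)
  show ?thesis
    by (intro finite_measureI)
      (simp add: rectangle_measure_def space_scale_measure emeasure_space_1 ennreal_mult_eq_top_iff)
qed

text \<open>
  The partial products of the normalising constants \<open>\<mu>\<^sub>i(C\<^sub>i)\<close> tend to the volume of \<open>C\<close>, and
  that is the scaling factor in \<open>rectangle_measure\<close>.  So they cancel, and the limit
  below is symmetric in \<open>C\<close> and \<open>E\<close>.
\<close>

lemma prod_measure_Int_tendsto:
  assumes C: "finite_rectangle M C" and pos: "0 < rectangle_volume M C"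
    and E: "\<And>i. E i \<in> sets (M i)"
  shows "(\<lambda>n. \<Prod>i<n. measure (M i) (C i \<inter> E i))
           \<longlonglongrightarrow> measure (rectangle_measure M C) (Pi\<^sub>E UNIV E)"
proof -
  let ?P = "\<lambda>i. uniform_measure (M i) (C i)"
  have "(\<lambda>n. (\<Prod>i<n. measure (M i) (C i)) * (\<Prod>i<n. measure (?P i) (E i)))
          \<longlonglongrightarrow> rectangle_volume M C * measure (PiM UNIV ?P) (Pi\<^sub>E UNIV E)"
    using prob_space_side[OF C pos] E
    by (intro tendsto_mult finite_rectangle_tendsto[OF C] prod_measure_tendsto_PiM) auto
  moreover have "measure (M i) (C i) * measure (?P i) (E i) = measure (M i) (C i \<inter> E i)" for i
  proof -
    have "emeasure (M i) (C i) \<noteq> 0" "emeasure (M i) (C i) \<noteq> \<infinity>"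
      using C measure_side_pos[OF C pos, of i] by (auto simp: finite_rectangle_def measure_def)
    then show ?thesis
      using E measure_side_pos[OF C pos, of i] by simp
  qed
  ultimately show ?thesis
    using volume_nonneg[OF C]
    by (simp add: prod.distrib[symmetric] rectangle_measure_def measure_def enn2real_mult)
qed

lemma emeasure_rectangle_measure_self:
  assumes C: "finite_rectangle M C"
  shows "emeasure (rectangle_measure M C) (Pi\<^sub>E UNIV C) = ennreal (rectangle_volume M C)"
proof (cases "rectangle_volume M C = 0")
  case True
  then show ?thesis by (simp add: rectangle_measure_def)
next
  case False
  then have pos: "0 < rectangle_volume M C"
    using volume_nonneg[OF C] by simp
  interpret finite_measure "rectangle_measure M C"
    by (rule finite_measure_rectangle_measure[OF C pos])
  have "measure (rectangle_measure M C) (Pi\<^sub>E UNIV C) = rectangle_volume M C"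
    using prod_measure_Int_tendsto[OF C pos, of C] finite_rectangle_tendsto[OF C]
      finite_rectangle_sets[OF C] by (auto intro: LIMSEQ_unique)
  then show ?thesis
    by (simp add: emeasure_eq_measure)
qed

section \<open>Compatibility of the rectangle measures\<close>

text \<open>
  Both sides are finite measures in \<open>X\<close>, so it suffices to compare them on cylinders
  \<open>\<Prod>Z\<^sub>i\<close>.  There each is the limit of the partial products of
  \<open>\<mu>\<^sub>i(C\<^sub>i \<inter> D\<^sub>i \<inter> Z\<^sub>i)\<close>.
\<close>

lemma rectangle_measure_Int_commute:
  assumes C: "finite_rectangle M C" "0 < rectangle_volume M C"
    and D: "finite_rectangle M D" "0 < rectangle_volume M D"
    and X: "X \<in> sets (PiM UNIV M)"
  shows "emeasure (rectangle_measure M D) (Pi\<^sub>E UNIV C \<inter> X)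
       = emeasure (rectangle_measure M C) (Pi\<^sub>E UNIV D \<inter> X)"
proof -
  interpret C: finite_measure "rectangle_measure M C"
    by (rule finite_measure_rectangle_measure[OF C])
  interpret D: finite_measure "rectangle_measure M D"
    by (rule finite_measure_rectangle_measure[OF D])
  note sides = finite_rectangle_sets[OF C(1)] finite_rectangle_sets[OF D(1)]
  have C_sets: "Pi\<^sub>E UNIV C \<in> sets (PiM UNIV M)" and D_sets: "Pi\<^sub>E UNIV D \<in> sets (PiM UNIV M)"
    by (auto intro!: sets_PiM_I_countable sides)
  have "density (rectangle_measure M D) (indicator (Pi\<^sub>E UNIV C))
      = density (rectangle_measure M C) (indicator (Pi\<^sub>E UNIV D))" (is "?D = ?C")
  proof (rule measure_eqI_PiM_infinite)
    show "sets ?D = sets (PiM UNIV M)" "sets ?C = sets (PiM UNIV M)"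
      by simp_all
    show "finite_measure ?D"
      using C_sets by (intro D.finite_measure_restricted) simp
  next
    fix A and J :: "nat set"
    assume J: "finite J" and A: "\<And>i. i \<in> J \<Longrightarrow> A i \<in> sets (M i)"
    define Z where "Z i = (if i \<in> J then A i else space (M i))" for i
    have Z_sets: "Z i \<in> sets (M i)" for i
      using A by (simp add: Z_def)
    have cylinder: "prod_emb UNIV M J (Pi\<^sub>E J A) = Pi\<^sub>E UNIV Z"
      using A[THEN sets.sets_into_space]
      by (fastforce simp: prod_emb_def PiE_iff Z_def split: if_splits)
    have Z_PiM: "Pi\<^sub>E UNIV Z \<in> sets (PiM UNIV M)"
      by (auto intro!: sets_PiM_I_countable Z_sets)
    have Int: "Pi\<^sub>E UNIV F \<inter> Pi\<^sub>E UNIV Z = Pi\<^sub>E UNIV (\<lambda>i. F i \<inter> Z i)" for F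
      by (simp add: PiE_Int)
    have "(\<lambda>n. \<Prod>i<n. measure (M i) (D i \<inter> (C i \<inter> Z i)))
            \<longlonglongrightarrow> measure (rectangle_measure M D) (Pi\<^sub>E UNIV (\<lambda>i. C i \<inter> Z i))"
      using Z_sets by (intro prod_measure_Int_tendsto[OF D]) (auto intro: sides)
    moreover have "(\<lambda>n. \<Prod>i<n. measure (M i) (C i \<inter> (D i \<inter> Z i)))
            \<longlonglongrightarrow> measure (rectangle_measure M C) (Pi\<^sub>E UNIV (\<lambda>i. D i \<inter> Z i))"
      using Z_sets by (intro prod_measure_Int_tendsto[OF C]) (auto intro: sides)
    ultimately have "measure (rectangle_measure M D) (Pi\<^sub>E UNIV (\<lambda>i. C i \<inter> Z i))
        = measure (rectangle_measure M C) (Pi\<^sub>E UNIV (\<lambda>i. D i \<inter> Z i))"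
      by (simp add: Int_left_commute LIMSEQ_unique)
    then show "emeasure ?D (prod_emb UNIV M J (Pi\<^sub>E J A))
        = emeasure ?C (prod_emb UNIV M J (Pi\<^sub>E J A))"
      using C_sets D_sets Z_PiM
      by (simp add: cylinder emeasure_restricted Int C.emeasure_eq_measure D.emeasure_eq_measure)
  qed
  then have "emeasure ?D X = emeasure ?C X"
    by simp
  then show ?thesis
    using C_sets D_sets X by (simp add: emeasure_restricted)
qed

text \<open>
  If \<open>C\<close> has volume 0, then the claim is that \<open>D \<inter> C\<close> is a null set for \<open>\<nu>\<^sub>D\<close>, and
  this follows from \<open>\<mu>\<^sub>i(D\<^sub>i \<inter> C\<^sub>i) \<le> \<mu>\<^sub>i(C\<^sub>i)\<close> in the limit.
\<close>

lemma rectangle_measure_le_on_rectangle: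
  assumes C: "finite_rectangle M C" and D: "finite_rectangle M D"
    and X: "X \<in> sets (PiM UNIV M)" and sub: "X \<subseteq> Pi\<^sub>E UNIV C"
  shows "emeasure (rectangle_measure M D) X \<le> emeasure (rectangle_measure M C) X"
proof (cases "rectangle_volume M D = 0")
  case True
  then show ?thesis by (simp add: rectangle_measure_def)
next
  case False
  then have D_pos: "0 < rectangle_volume M D"
    using volume_nonneg[OF D] by simp
  interpret D: finite_measure "rectangle_measure M D"
    by (rule finite_measure_rectangle_measure[OF D D_pos])
  have C_sets: "Pi\<^sub>E UNIV C \<in> sets (PiM UNIV M)"
    by (auto intro!: sets_PiM_I_countable finite_rectangle_sets[OF C])
  show ?thesis
  proof (cases "rectangle_volume M C = 0")
    case True
    have "measure (rectangle_measure M D) (Pi\<^sub>E UNIV C) \<le> rectangle_volume M C"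
    proof (rule LIMSEQ_le)
      show "(\<lambda>n. \<Prod>i<n. measure (M i) (D i \<inter> C i))
              \<longlonglongrightarrow> measure (rectangle_measure M D) (Pi\<^sub>E UNIV C)"
        by (intro prod_measure_Int_tendsto D D_pos finite_rectangle_sets[OF C])
      show "(\<lambda>n. \<Prod>i<n. measure (M i) (C i)) \<longlonglongrightarrow> rectangle_volume M C"
        by (rule finite_rectangle_tendsto[OF C])
      have "measure (M i) (D i \<inter> C i) \<le> measure (M i) (C i)" for i
        using C D by (intro measure_mono_fmeasurable) (auto simp: finite_rectangle_def fmeasurable_def)
      then show "\<exists>N. \<forall>n\<ge>N. (\<Prod>i<n. measure (M i) (D i \<inter> C i)) \<le> (\<Prod>i<n. measure (M i) (C i))"
        by (auto intro!: prod_mono)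
    qed
    then have "emeasure (rectangle_measure M D) (Pi\<^sub>E UNIV C) = 0"
      using True by (simp add: D.emeasure_eq_measure measure_le_0_iff)
    moreover have "emeasure (rectangle_measure M D) X
        \<le> emeasure (rectangle_measure M D) (Pi\<^sub>E UNIV C)"
      using sub C_sets by (intro emeasure_mono) auto
    ultimately show ?thesis by simp
  next
    case False
    then have C_pos: "0 < rectangle_volume M C"
      using volume_nonneg[OF C] by simp
    have "emeasure (rectangle_measure M D) X = emeasure (rectangle_measure M D) (Pi\<^sub>E UNIV C \<inter> X)"
      using sub by (simp add: Int_absorb1)
    also have "\<dots> = emeasure (rectangle_measure M C) (Pi\<^sub>E UNIV D \<inter> X)"
      by (rule rectangle_measure_Int_commute[OF C C_pos D D_pos X])
    also have "\<dots> \<le> emeasure (rectangle_measure M C) X"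
      using X by (intro emeasure_mono) auto
    finally show ?thesis .
  qed
qed

section \<open>The product measure\<close>

theorem theorem1p3:
  fixes M :: "nat \<Rightarrow> 'a measure"
  shows "\<exists>N :: (nat \<Rightarrow> 'a) measure.
           space N = Pi\<^sub>E UNIV (\<lambda>i. space (M i)) \<and>
           sets N = sets (PiM UNIV M) \<and>
           (\<forall>C. finite_rectangle M C \<longrightarrow>
              emeasure N (Pi\<^sub>E UNIV C) = ennreal (inf_prod (\<lambda>i. measure (M i) (C i))))"
proof -
  let ?I = "Collect (finite_rectangle M)"
  define N where "N = (SUP D\<in>?I. rectangle_measure M D)"
  \<comment> \<open>The supremum must not be over the empty family, or it would live on the wrong \<open>\<sigma>\<close>-algebra.\<close>
  have "(\<lambda>n. \<Prod>i<n. measure (M i) {}) \<longlonglongrightarrow> 0"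
    by (intro tendsto_eventually eventually_sequentiallyI[of 1]) auto
  then have "finite_rectangle M (\<lambda>i. {})"
    unfolding finite_rectangle_def inf_prod_exists_def by (auto intro: convergentI)
  then have nonempty: "?I \<noteq> {}"
    by auto
  have sets_N: "sets N = sets (PiM UNIV M)"
    unfolding N_def using nonempty by (intro sets_SUP) auto
  have "emeasure N (Pi\<^sub>E UNIV C) = ennreal (rectangle_volume M C)" if C: "finite_rectangle M C" for C
  proof (rule antisym)
    have "emeasure N (Pi\<^sub>E UNIV C) \<le> emeasure (rectangle_measure M C) (Pi\<^sub>E UNIV C)"
      unfolding N_def
    proof (rule emeasure_SUP_le_on[OF nonempty])
      show "Pi\<^sub>E UNIV C \<in> sets (rectangle_measure M C)"
        by (auto intro!: sets_PiM_I_countable finite_rectangle_sets[OF C])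
    qed (auto intro: rectangle_measure_le_on_rectangle[OF C])
    then show "emeasure N (Pi\<^sub>E UNIV C) \<le> ennreal (rectangle_volume M C)"
      by (simp add: emeasure_rectangle_measure_self[OF C])
    have "rectangle_measure M C \<le> N"
      unfolding N_def using C by (intro SUP_upper) simp
    then have "emeasure (rectangle_measure M C) (Pi\<^sub>E UNIV C) \<le> emeasure N (Pi\<^sub>E UNIV C)"
      by (rule le_measureD3) (simp add: sets_N)
    then show "ennreal (rectangle_volume M C) \<le> emeasure N (Pi\<^sub>E UNIV C)"
      by (simp add: emeasure_rectangle_measure_self[OF C])
  qed
  moreover have "space N = Pi\<^sub>E UNIV (\<lambda>i. space (M i))"
    using sets_eq_imp_space_eq[OF sets_N] by (simp add: space_PiM)
  ultimately show ?thesis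
    using sets_N by blast
qed

end
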